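(* Let $N\ge2$ and let $(r^{N-1}V,r^{N-1}W)$ be a Bessel pair on $(0,\infty)$ with positive solution $f$ on $(0,\infty)$. Then for all $u\in C_c^\infty(\mathbb{H}^N\setminus\{x_0\})$ (not necessarily radial), $$\begin{aligned}\int_{\mathbb{H}^N}V(r)|\Delta_{r,\mathbb{H}^N}u|^2\,dv_{\mathbb{H}^N}={}&\int_{\mathbb{H}^N}W(r)|\nabla_{r,\mathbb{H}^N}u|^2\,dv_{\mathbb{H}^N}\\&+(N-1)\int_{\mathbb{H}^N}\left(\frac{V(r)}{\sinh^2 r}-\frac{V_r(r)\cosh r}{\sinh r}\right)|\nabla_{r,\mathbb{H}^N}u|^2\,dv_{\mathbb{H}^N}\\&-(N-1)\int_{\mathbb{H}^N}V(r)\frac{f'(r)}{f(r)}\left(\coth r-\frac1r\right)|\nabla_{r,\mathbb{H}^N}u|^2\,dv_{\mathbb{H}^N}\\&+\int_{\mathbb{H}^N}V(r)(f(r))^2\left|\nabla_{r,\mathbb{H}^N}\left(\frac{u_r}{f(r)}\right)\right|^2dv_{\mathbb{H}^N}.\end{aligned}$$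
   Context: $\mathbb{H}^N$ is the $N$-dimensional hyperbolic space (constant curvature $-1$) with Riemannian volume $dv_{\mathbb{H}^N}$; $x_0\in\mathbb{H}^N$ is a fixed pole and $r=d(x,x_0)$ is the geodesic distance. In polar coordinates $(r,\Theta)\in(0,\infty)\times\mathbb{S}^{N-1}$ about $x_0$, $dv_{\mathbb{H}^N}=(\sinh r)^{N-1}\,dr\,d\Theta$. Functions are real-valued. With $u_r=\frac{\partial u}{\partial r}$, the radial gradient is $\nabla_{r,\mathbb{H}^N}u=(u_r,0)$, so $|\nabla_{r,\mathbb{H}^N}u|^2=u_r^2$, and the radial Laplacian is $\Delta_{r,\mathbb{H}^N}u=u_{rr}+(N-1)\coth r\,u_r$. Also $V_r=V'$. A pair $(\tilde V,\tilde W)$ of $C^1$ functions is a Bessel pair on $(0,\infty)$ if the ordinary differential equation $(\tilde V y')'+\tilde W y=0$ admits a positive solution on $(0,\infty)$. Thus here $V,W$ are $C^1$ functions on $(0,\infty)$ and $f>0$ satisfies $(r^{N-1}Vf')'+r^{N-1}Wf=0$ on $(0,\infty)$. *)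

theory Defs
  imports "HOL-Analysis.Analysis"
begin

text \<open>
  The hyperboloid model of \<open>N\<close>-dimensional hyperbolic space, \<open>N = DIM('a)\<close>, inside
  Minkowski space \<open>real \<times> 'a\<close> with the time coordinate first.
\<close>

definition lorentz :: "real \<times> 'a::euclidean_space \<Rightarrow> real \<times> 'a \<Rightarrow> real" where
  "lorentz p q = snd p \<bullet> snd q - fst p * fst q"

definition hyperboloid :: "(real \<times> 'a::euclidean_space) set" where
  "hyperboloid = {p. lorentz p p = -1 \<and> fst p > 0}"

definition hyp_dist :: "real \<times> 'a::euclidean_space \<Rightarrow> real \<times> 'a \<Rightarrow> real" where
  "hyp_dist p q = arcosh (- lorentz p q)"

text \<open>A global parametrisation: the hyperboloid is a graph over \<open>'a\<close>.\<close>

definition hyp_chart :: "'a::euclidean_space \<Rightarrow> real \<times> 'a" where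
  "hyp_chart y = (sqrt (1 + (norm y)\<^sup>2), y)"

text \<open>
  In this chart the metric induced by \<^const>\<open>lorentz\<close> has matrix
  \<open>G = I - y y\<^sup>T / (1 + |y|\<^sup>2)\<close>, hence \<open>det G = 1 / (1 + |y|\<^sup>2)\<close>, and the
  Riemannian volume is \<open>sqrt (det G) dy\<close>.
\<close>

definition hyp_volume :: "(real \<times> 'a::euclidean_space) measure" where
  "hyp_volume =
    distr (density lborel (\<lambda>y::'a. ennreal (1 / sqrt (1 + (norm y)\<^sup>2))))
      (restrict_space borel hyperboloid) hyp_chart"

primrec C_k :: "nat \<Rightarrow> ('a::euclidean_space \<Rightarrow> real) \<Rightarrow> bool" where
  "C_k 0 g \<longleftrightarrow> continuous_on UNIV g"
| "C_k (Suc k) g \<longleftrightarrow>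
     (\<forall>y. g differentiable (at y)) \<and> (\<forall>v. C_k k (\<lambda>y. frechet_derivative g (at y) v))"

definition C_infinity :: "('a::euclidean_space \<Rightarrow> real) \<Rightarrow> bool" where
  "C_infinity g \<longleftrightarrow> (\<forall>k. C_k k g)"

text \<open>
  \<open>C\<^sub>c\<^sup>\<infinity>(U)\<close> for an open subset \<open>U\<close> of the hyperboloid, every function being extended by
  zero to the whole hyperboloid. Values off the hyperboloid are irrelevant.
\<close>

definition Cc_infinity :: "(real \<times> 'a::euclidean_space) set \<Rightarrow> (real \<times> 'a \<Rightarrow> real) set" where
  "Cc_infinity U =
    {u. C_infinity (u \<circ> hyp_chart) \<and>
        (\<exists>K. compact K \<and> K \<subseteq> U \<and> (\<forall>x \<in> hyperboloid - K. u x = 0))}"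

text \<open>
  \<open>hyp_polar x0 s \<Theta>\<close> is the exponential map at \<open>x0\<close> applied to \<open>s \<Theta>\<close>, where \<open>\<Theta>\<close> is a unit
  tangent vector at \<open>x0\<close> (\<open>lorentz x0 \<Theta> = 0\<close>, \<open>lorentz \<Theta> \<Theta> = 1\<close>); \<open>hyp_angle x0 x\<close> is the
  angular coordinate \<open>\<Theta>\<close> of a point \<open>x \<noteq> x0\<close> of the hyperboloid. The radial operators below
  have no meaning at \<open>x = x0\<close>, which is a null set for \<^const>\<open>hyp_volume\<close>.
\<close>

definition hyp_polar :: "real \<times> 'a::euclidean_space \<Rightarrow> real \<Rightarrow> real \<times> 'a \<Rightarrow> real \<times> 'a" where
  "hyp_polar x0 s \<Theta> = cosh s *\<^sub>R x0 + sinh s *\<^sub>R \<Theta>"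

definition hyp_angle :: "real \<times> 'a::euclidean_space \<Rightarrow> real \<times> 'a \<Rightarrow> real \<times> 'a" where
  "hyp_angle x0 x =
    (1 / sinh (hyp_dist x x0)) *\<^sub>R (x - cosh (hyp_dist x x0) *\<^sub>R x0)"

definition radial_deriv ::
    "real \<times> 'a::euclidean_space \<Rightarrow> (real \<times> 'a \<Rightarrow> real) \<Rightarrow> real \<times> 'a \<Rightarrow> real" where
  "radial_deriv x0 u x = deriv (\<lambda>s. u (hyp_polar x0 s (hyp_angle x0 x))) (hyp_dist x x0)"

text \<open>The unit tangent vector \<open>\<partial>/\<partial>r\<close> at \<open>x\<close>: the velocity of the geodesic from \<open>x0\<close>.\<close>

definition radial_unit :: "real \<times> 'a::euclidean_space \<Rightarrow> real \<times> 'a \<Rightarrow> real \<times> 'a" where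
  "radial_unit x0 x =
    vector_derivative (\<lambda>s. hyp_polar x0 s (hyp_angle x0 x)) (at (hyp_dist x x0))"

definition radial_grad ::
    "real \<times> 'a::euclidean_space \<Rightarrow> (real \<times> 'a \<Rightarrow> real) \<Rightarrow> real \<times> 'a \<Rightarrow> real \<times> 'a" where
  "radial_grad x0 u x = radial_deriv x0 u x *\<^sub>R radial_unit x0 x"

text \<open>Squared Riemannian length of a tangent vector to the hyperboloid.\<close>

definition hyp_normsq :: "real \<times> 'a::euclidean_space \<Rightarrow> real" where
  "hyp_normsq v = lorentz v v"

definition coth :: "real \<Rightarrow> real" where
  "coth t = cosh t / sinh t"

definition radial_laplacian ::
    "real \<times> 'a::euclidean_space \<Rightarrow> (real \<times> 'a \<Rightarrow> real) \<Rightarrow> real \<times> 'a \<Rightarrow> real" where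
  "radial_laplacian x0 u x =
    radial_deriv x0 (radial_deriv x0 u) x
      + (real DIM('a) - 1) * coth (hyp_dist x x0) * radial_deriv x0 u x"

text \<open>
  Positive classical solutions of \<open>(P y')' + Q y = 0\<close> on \<open>(0,\<infinity>)\<close>. As \<open>P\<close> may vanish, only
  \<open>y\<close> and \<open>P y'\<close> are required to be \<open>C\<^sup>1\<close> (for \<open>P y'\<close> this follows from the equation), not
  that \<open>y\<close> is \<open>C\<^sup>2\<close>.
\<close>

definition positive_solution ::
    "(real \<Rightarrow> real) \<Rightarrow> (real \<Rightarrow> real) \<Rightarrow> (real \<Rightarrow> real) \<Rightarrow> bool" where
  "positive_solution P Q y \<longleftrightarrow>
    y C1_differentiable_on {0<..} \<and> (\<forall>r>0. y r > 0) \<and>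
    (\<forall>r>0. (\<lambda>s. P s * deriv y s) differentiable (at r) \<and>
            deriv (\<lambda>s. P s * deriv y s) r + Q r * y r = 0)"

definition bessel_pair :: "(real \<Rightarrow> real) \<Rightarrow> (real \<Rightarrow> real) \<Rightarrow> bool" where
  "bessel_pair P Q \<longleftrightarrow>
    P C1_differentiable_on {0<..} \<and> Q C1_differentiable_on {0<..} \<and>
    (\<exists>y. positive_solution P Q y)"

end

theory Submission
  imports Defs
begin

text \<open>
  Put \<open>A = (N - 1) V coth r + V f'/f\<close>. Pointwise, the integrands of the two sides differ by
  \<open>\<partial>\<^sub>r(A u\<^sub>r\<^sup>2) + (N - 1) coth r (A u\<^sub>r\<^sup>2)\<close>: the equation for \<open>f\<close> is what eliminates
  \<open>(V f')'\<close>. Since the unit radial field has divergence \<open>(N - 1) coth r\<close>, this is the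
  divergence of the compactly supported field \<open>A u\<^sub>r\<^sup>2 \<partial>\<^sub>r\<close>, so it integrates to zero. In the
  graph chart the radial field and the density are explicit, so the divergence theorem reduces to
  the vanishing of Euclidean integrals of directional derivatives, and no integration in polar
  coordinates is needed.
\<close>

section \<open>Continuously differentiable functions\<close>

text \<open>Completing squares dictates \<open>A\<close>: in
  \<open>V (u_rr + (N - 1) coth r u_r)^2 - V (u_rr - u_r f'/f)^2\<close> the part containing
  \<open>u_rr\<close> is exactly \<open>A\<close> times the radial derivative of
  \<open>u_r^2\<close>, and the second square is the last integrand of the claim. The Bessel
  equation carries the Euclidean weight \<open>r^(N - 1)\<close>, while the divergence of the radial
  field is hyperbolic; the mismatch of \<open>(N - 1) / r\<close> and \<open>(N - 1) coth r\<close>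
  is the origin of the factor \<open>coth r - 1 / r\<close>. Two obstacles shape the proof. At the
  pole the radial field is singular and the radial operators return arbitrary values, so fields are
  extended by zero across it and pointwise identities leave out this one null point. Moreover
  \<open>f\<close> is only C1 and \<open>V\<close> may vanish, so the argument stays within C1
  functions and never mentions \<open>f''\<close>.\<close>

definition C1_on :: "'a::real_normed_vector set \<Rightarrow> ('a \<Rightarrow> real) \<Rightarrow> bool" where
  "C1_on S g \<longleftrightarrow> (\<forall>y\<in>S. g differentiable (at y)) \<and>
     (\<forall>v. continuous_on S (\<lambda>y. frechet_derivative g (at y) v))"

lemma C1_onI:
  assumes "\<And>y. y \<in> S \<Longrightarrow> (g has_derivative g' y) (at y)"
    and "\<And>v. continuous_on S (\<lambda>y. g' y v)"
  shows "C1_on S g"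
proof -
  have "frechet_derivative g (at y) = g' y" if "y \<in> S" for y
    using frechet_derivative_at[OF assms(1)[OF that]] by simp
  then show ?thesis
    using assms unfolding C1_on_def
    by (auto simp: differentiable_def cong: continuous_on_cong)
qed

lemma C1_on_has_derivative:
  "C1_on S g \<Longrightarrow> y \<in> S \<Longrightarrow> (g has_derivative frechet_derivative g (at y)) (at y)"
  by (simp add: C1_on_def frechet_derivative_works)

lemma C1_on_continuous_derivative:
  "C1_on S g \<Longrightarrow> continuous_on S (\<lambda>y. frechet_derivative g (at y) v)"
  by (simp add: C1_on_def)

lemma C1_on_continuous: "C1_on S g \<Longrightarrow> continuous_on S g"
  unfolding C1_on_def
  by (meson continuous_at_imp_continuous_on differentiable_imp_continuous_within)

lemma C1_on_cong:
  assumes "C1_on S g" "open S" "\<And>y. y \<in> S \<Longrightarrow> h y = g y"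
  shows "C1_on S h"
proof (rule C1_onI)
  fix y assume "y \<in> S"
  show "(h has_derivative frechet_derivative g (at y)) (at y)"
    using C1_on_has_derivative[OF assms(1) \<open>y \<in> S\<close>] assms(2) \<open>y \<in> S\<close>
    by (rule has_derivative_transform_within_open) (simp add: assms(3))
qed (rule C1_on_continuous_derivative[OF assms(1)])

lemma C1_on_const: "C1_on S (\<lambda>_. k)"
  by (rule C1_onI[where g' = "\<lambda>_ _. 0"]) auto

lemma C1_on_inner: "C1_on S (\<lambda>y. y \<bullet> k)"
  by (rule C1_onI[where g' = "\<lambda>_ v. v \<bullet> k"]) (auto intro!: derivative_eq_intros)

lemma C1_on_add:
  assumes "C1_on S g" "C1_on S h"
  shows "C1_on S (\<lambda>y. g y + h y)"
  using C1_on_continuous_derivative[OF assms(1)] C1_on_continuous_derivative[OF assms(2)]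
  by (intro C1_onI[OF has_derivative_add[OF C1_on_has_derivative[OF assms(1)]
        C1_on_has_derivative[OF assms(2)]]] continuous_intros)

lemma C1_on_mult:
  assumes "C1_on S g" "C1_on S h"
  shows "C1_on S (\<lambda>y. g y * h y)"
  using C1_on_continuous_derivative[OF assms(1)] C1_on_continuous_derivative[OF assms(2)]
    C1_on_continuous[OF assms(1)] C1_on_continuous[OF assms(2)]
  by (intro C1_onI[OF has_derivative_mult[OF C1_on_has_derivative[OF assms(1)]
        C1_on_has_derivative[OF assms(2)]]] continuous_intros)

lemma C1_on_sum:
  assumes "finite I" "\<And>i. i \<in> I \<Longrightarrow> C1_on S (g i)"
  shows "C1_on S (\<lambda>y. \<Sum>i\<in>I. g i y)"
  using assms by (induction I rule: finite_induct) (auto intro: C1_on_add C1_on_const)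

lemma C1_on_compose:
  fixes q :: "real \<Rightarrow> real"
  assumes g: "C1_on S g" and im: "\<And>y. y \<in> S \<Longrightarrow> g y \<in> T"
    and q: "\<And>t. t \<in> T \<Longrightarrow> (q has_real_derivative q' t) (at t)" and cont: "continuous_on T q'"
  shows "C1_on S (\<lambda>y. q (g y))"
proof (rule C1_onI)
  fix y assume "y \<in> S"
  show "((\<lambda>y. q (g y)) has_derivative (\<lambda>v. frechet_derivative g (at y) v * q' (g y))) (at y)"
    using DERIV_compose_FDERIV[OF q[OF im[OF \<open>y \<in> S\<close>]] C1_on_has_derivative[OF g \<open>y \<in> S\<close>]] .
next
  fix v
  show "continuous_on S (\<lambda>y. frechet_derivative g (at y) v * q' (g y))"
    using g im C1_on_continuous[OF g]
    by (intro continuous_intros C1_on_continuous_derivative continuous_on_compose2[OF cont]) auto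
qed

text \<open>\<open>S\<close> and the complement of \<open>K\<close> form an open cover of the space,
  and on the second set the extension is identically zero, so regularity may be checked on each
  piece. This turns fields on the punctured chart into global ones.\<close>

lemma C1_on_extend_zero:
  fixes g :: "'a::euclidean_space \<Rightarrow> real"
  assumes g: "C1_on S g" and "open S" and "compact K" "K \<subseteq> S"
    and zero: "\<And>y. y \<in> S - K \<Longrightarrow> g y = 0"
  shows "C1_on UNIV (\<lambda>y. if y \<in> S then g y else 0)"
proof -
  have K: "open (- K)" using \<open>compact K\<close> by (simp add: compact_imp_closed open_Compl)
  let ?g = "\<lambda>y. if y \<in> S then g y else 0"
  have 1: "C1_on S ?g" by (rule C1_on_cong[OF g \<open>open S\<close>]) simp
  have 2: "C1_on (- K) ?g" by (rule C1_on_cong[OF C1_on_const[of _ 0] K]) (use zero in auto)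
  have U: "S \<union> - K = UNIV" using \<open>K \<subseteq> S\<close> by auto
  have "continuous_on (S \<union> - K) (\<lambda>y. frechet_derivative ?g (at y) v)" for v
    using 1 2 \<open>open S\<close> K by (intro continuous_on_open_Un C1_on_continuous_derivative)
  then show ?thesis
    using 1 2 U unfolding C1_on_def by (metis UnE)
qed

lemma frechet_derivative_eq_0:
  assumes "open S" "y \<in> S" "\<And>z. z \<in> S \<Longrightarrow> g z = 0"
  shows "frechet_derivative g (at y) = (\<lambda>_. 0)"
proof -
  have "(g has_derivative (\<lambda>_. 0)) (at y)"
    by (rule has_derivative_transform_within_open[OF has_derivative_const[of 0] assms(1,2)])
      (simp add: assms(3))
  then show ?thesis using frechet_derivative_at by metis
qed

text \<open>The order 1 clause of \<open>C_k\<close> and \<open>C1_on\<close> ask for the same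
  thing, continuity of each derivative in a fixed direction, so continuity in operator norm never
  has to be discussed.\<close>

lemma C_infinity_C1_on: "C_infinity g \<Longrightarrow> C1_on S g"
proof -
  assume "C_infinity g"
  then have "C_k (Suc 0) g" unfolding C_infinity_def by blast
  then show ?thesis by (auto simp: C1_on_def intro: continuous_on_subset)
qed

lemma C_infinity_derivative: "C_infinity g \<Longrightarrow> C_infinity (\<lambda>y. frechet_derivative g (at y) v)"
  unfolding C_infinity_def by (metis C_k.simps(2))

section \<open>Integrals of derivatives\<close>

lemma integrable_continuous_compact_support:
  fixes g :: "'a::euclidean_space \<Rightarrow> real"
  assumes "compact K" "continuous_on K g" "\<And>y. y \<notin> K \<Longrightarrow> g y = 0"
  shows "integrable lborel g"
proof -
  have "g = (\<lambda>y. indicator K y *\<^sub>R g y)" using assms(3) by (auto simp: fun_eq_iff indicator_def)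
  then show ?thesis using borel_integrable_compact[OF assms(1,2)] by simp
qed

text \<open>The difference quotients have integral zero by translation invariance of \<^const>\<open>lborel\<close>.\<close>

lemma integral_derivative_eq_0:
  fixes g :: "'a::euclidean_space \<Rightarrow> real"
  assumes g: "C1_on UNIV g" and "compact K" and zero: "\<And>y. y \<notin> K \<Longrightarrow> g y = 0"
  shows "integrable lborel (\<lambda>y. frechet_derivative g (at y) v)" (is "integrable _ ?D")
    and "(LINT y|lborel. frechet_derivative g (at y) v) = 0"
proof -
  have contD: "continuous_on UNIV ?D" by (rule C1_on_continuous_derivative[OF g])
  have contg: "continuous_on UNIV g" by (rule C1_on_continuous[OF g])
  have K: "open (- K)" using \<open>compact K\<close> by (simp add: compact_imp_closed open_Compl)
  have zeroD: "?D y = 0" if "y \<notin> K" for y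
    using frechet_derivative_eq_0[OF K, of y g] zero that by simp
  show intD: "integrable lborel ?D"
    using integrable_continuous_compact_support[OF \<open>compact K\<close> continuous_on_subset[OF contD]] zeroD
    by simp
  have intg: "integrable lborel g"
    using integrable_continuous_compact_support[OF \<open>compact K\<close> continuous_on_subset[OF contg]] zero
    by simp
  have "bounded (?D ` K)"
    by (intro compact_imp_bounded compact_continuous_image \<open>compact K\<close>
        continuous_on_subset[OF contD]) simp
  then obtain M where "M > 0" "\<And>y. y \<in> K \<Longrightarrow> \<bar>?D y\<bar> \<le> M"
    unfolding bounded_pos by (auto simp: image_iff)
  then have M: "\<bar>?D y\<bar> \<le> M" for y by (cases "y \<in> K") (auto simp: zeroD)
  \<comment> \<open>\<open>K\<close> swept along \<open>- v\<close> for unit time. As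
    \<open>0 < t n \<le> 1\<close>, it contains every \<open>y\<close> for which \<open>y\<close> or
    \<open>y + t n *\<^sub>R v\<close> lies in \<open>K\<close>, so all the difference quotients
    vanish off one compact set.\<close>
  define L where "L = {a + b | a b. a \<in> K \<and> b \<in> (\<lambda>t. - t *\<^sub>R v) ` {0..1::real}}"
  have "compact L"
    unfolding L_def by (intro compact_sums \<open>compact K\<close> compact_continuous_image continuous_intros) auto
  define t where "t n = 1 / real (Suc n)" for n
  have t: "0 < t n" "t n \<le> 1" for n by (auto simp: t_def)
  have tlim: "t \<longlonglongrightarrow> 0" unfolding t_def by (rule LIMSEQ_Suc[OF lim_1_over_n])
  define s where "s n y = (g (y + t n *\<^sub>R v) - g y) / t n" for n y
  have der: "((\<lambda>t. g (y + t *\<^sub>R v)) has_real_derivative ?D (y + t *\<^sub>R v)) (at t)" for y t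
  proof -
    have D: "(g has_derivative frechet_derivative g (at (y + t *\<^sub>R v))) (at (y + t *\<^sub>R v))"
      by (rule C1_on_has_derivative[OF g]) simp
    have "((\<lambda>t. y + t *\<^sub>R v) has_derivative (\<lambda>h. h *\<^sub>R v)) (at t)"
      by (auto intro!: derivative_eq_intros)
    from has_derivative_compose[OF this D] show ?thesis
      unfolding has_field_derivative_def
      by (rule has_derivative_eq_rhs)
        (auto simp: linear_cmul[OF has_derivative_linear[OF D]])
  qed
  have bound: "norm (s n y) \<le> M * indicator L y" for n y
  proof (cases "y \<in> L")
    case True
    \<comment> \<open>The mean value theorem makes the quotient a value of the directional
      derivative, hence bounded by \<open>M\<close> uniformly in \<open>n\<close>.\<close>
    obtain z where "g (y + t n *\<^sub>R v) - g (y + 0 *\<^sub>R v) = (t n - 0) * ?D (y + z *\<^sub>R v)"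
      using MVT2[OF t(1) der] by blast
    then have "s n y = ?D (y + z *\<^sub>R v)" using t(1)[of n] by (simp add: s_def)
    then show ?thesis using M True by simp
  next
    case False
    have "y \<notin> K"
    proof
      assume "y \<in> K"
      then have "y = y + (- 0 *\<^sub>R v)" "y \<in> K" "(- 0 *\<^sub>R v) \<in> (\<lambda>t. - t *\<^sub>R v) ` {0..1::real}" by auto
      then show False using False unfolding L_def by blast
    qed
    moreover have "y + t n *\<^sub>R v \<notin> K"
    proof
      assume "y + t n *\<^sub>R v \<in> K"
      moreover have "y = (y + t n *\<^sub>R v) + (- t n *\<^sub>R v)" by simp
      moreover have "- t n *\<^sub>R v \<in> (\<lambda>t. - t *\<^sub>R v) ` {0..1::real}" using t[of n] by force
      ultimately show False using False unfolding L_def by blast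
    qed
    ultimately show ?thesis using False zero by (simp add: s_def)
  qed
  have "(\<lambda>n. integral\<^sup>L lborel (s n)) \<longlonglongrightarrow> integral\<^sup>L lborel ?D"
  proof (rule integral_dominated_convergence)
    show "?D \<in> borel_measurable lborel" using contD by (simp add: borel_measurable_continuous_onI)
    show "s n \<in> borel_measurable lborel" for n
      unfolding s_def measurable_lborel2
      by (intro borel_measurable_continuous_onI continuous_intros continuous_on_compose2[OF contg])
        (use t(1)[of n] in auto)
    show "integrable lborel (\<lambda>y. M * indicator L y)"
      using emeasure_compact_finite[OF \<open>compact L\<close>] \<open>compact L\<close>
      by (intro integrable_mult_right integrable_real_indicator) (auto simp: borel_compact)
    show "AE y in lborel. norm (s n y) \<le> M * indicator L y" for n using bound by simp
    show "AE y in lborel. (\<lambda>n. s n y) \<longlonglongrightarrow> ?D y"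
    proof (rule AE_I2)
      fix y
      have "(\<lambda>h. (g (y + h *\<^sub>R v) - g y) / h) \<midarrow>0\<rightarrow> ?D y"
        using der[of y 0] by (simp add: has_field_derivative_iff)
      then have "(\<lambda>n. (g (y + t n *\<^sub>R v) - g y) / t n) \<longlonglongrightarrow> ?D y"
        by (rule filterlim_compose)
          (use tlim t(1) in \<open>auto simp: filterlim_at less_imp_neq[symmetric] intro!: always_eventually\<close>)
      then show "(\<lambda>n. s n y) \<longlonglongrightarrow> ?D y" by (simp add: s_def)
    qed
  qed
  moreover have "integral\<^sup>L lborel (s n) = 0" for n
  proof -
    have meas: "g \<in> borel_measurable borel" using contg by (rule borel_measurable_continuous_onI)
    have "integrable (distr lborel borel ((+) (t n *\<^sub>R v))) g"
      unfolding lborel_distr_plus by (rule intg)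
    then have i: "integrable lborel (\<lambda>y. g (y + t n *\<^sub>R v))"
      by (subst (asm) integrable_distr_eq) (auto simp: meas add.commute)
    have "integral\<^sup>L lborel g = integral\<^sup>L (distr lborel borel ((+) (t n *\<^sub>R v))) g"
      unfolding lborel_distr_plus ..
    also have "\<dots> = (LINT y|lborel. g (y + t n *\<^sub>R v))"
      by (subst integral_distr) (auto simp: meas add.commute)
    finally show ?thesis using i intg by (simp add: s_def[abs_def])
  qed
  ultimately show "(LINT y|lborel. ?D y) = 0" by (simp add: LIMSEQ_const_iff)
qed

section \<open>The hyperboloid in the graph chart\<close>

lemma hyp_chart_in_hyperboloid: "hyp_chart y \<in> hyperboloid"
  by (simp add: hyp_chart_def hyperboloid_def lorentz_def power2_norm_eq_inner add_pos_nonneg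
      flip: power2_eq_square)

lemma hyp_chart_snd:
  assumes "x \<in> hyperboloid"
  shows "hyp_chart (snd x) = x"
proof -
  have "1 + (norm (snd x))\<^sup>2 = (fst x)\<^sup>2" "0 < fst x"
    using assms by (auto simp: hyperboloid_def lorentz_def power2_norm_eq_inner
        power2_eq_square[of "fst x"])
  then show ?thesis by (simp add: hyp_chart_def prod_eq_iff real_sqrt_unique)
qed

lemma snd_hyp_chart [simp]: "snd (hyp_chart y) = y"
  by (simp add: hyp_chart_def)

lemma continuous_hyp_chart: "continuous_on S hyp_chart"
  unfolding hyp_chart_def by (intro continuous_intros)

text \<open>The point \<open>b\<close> will be the pole, where radial quantities take whatever value
  \<open>deriv\<close> happens to return; being a single point, it is null. Values of
  \<open>F\<close> off the hyperboloid do not enter, since \<open>hyp_volume\<close> lives on the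
  restricted sigma-algebra.\<close>

lemma integral_hyp_volume:
  fixes F :: "real \<times> 'a::euclidean_space \<Rightarrow> real"
  assumes "compact K" and cont: "continuous_on K (\<lambda>y. F (hyp_chart y))"
    and zero: "\<And>y. y \<notin> K \<Longrightarrow> y \<noteq> b \<Longrightarrow> F (hyp_chart y) = 0"
  shows "integrable hyp_volume F"
    and "(LINT x|hyp_volume. F x) = (LINT y|lborel. 1 / sqrt (1 + (norm y)\<^sup>2) * F (hyp_chart y))"
proof -
  let ?F = "\<lambda>y. F (hyp_chart y)" and ?\<rho> = "\<lambda>y::'a. 1 / sqrt (1 + (norm y)\<^sup>2)"
  have \<rho>: "continuous_on S ?\<rho>" for S
    by (intro continuous_intros) (smt (verit) real_sqrt_eq_zero_cancel_iff zero_le_power2)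
  have [measurable]: "?\<rho> \<in> borel_measurable borel"
    by (rule borel_measurable_continuous_onI[OF \<rho>])
  have "closed K" using \<open>compact K\<close> by (rule compact_imp_closed)
  have "(\<lambda>y. indicator K y *\<^sub>R ?F y) \<in> borel_measurable borel"
    using \<open>closed K\<close> cont by (intro borel_measurable_continuous_on_indicator) auto
  then have m: "?F \<in> borel_measurable borel"
    by (rule measurable_discrete_difference[where X = "{b}"]) (auto simp: indicator_def zero)
  have chart: "hyp_chart \<in> measurable (density lborel (\<lambda>y. ennreal (?\<rho> y))) (restrict_space borel hyperboloid)"
    by (intro measurable_restrict_space2)
      (auto simp: hyp_chart_in_hyperboloid continuous_hyp_chart borel_measurable_continuous_onI)
  \<comment> \<open>On the hyperboloid \<open>F\<close> agrees with
    \<open>F \<circ> hyp_chart \<circ> snd\<close>; this carries measurability in the chart over to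
    \<open>F\<close> itself.\<close>
  have "(\<lambda>x::real \<times> 'a. ?F (snd x)) \<in> borel_measurable borel"
    using m by (rule measurable_compose[rotated])
      (intro borel_measurable_continuous_onI continuous_intros)
  then have "(\<lambda>x. ?F (snd x)) \<in> borel_measurable (restrict_space borel hyperboloid)"
    by (rule measurable_restrict_space1)
  then have F: "F \<in> borel_measurable (restrict_space borel hyperboloid)"
    by (subst measurable_cong[where g = "\<lambda>x. ?F (snd x)"]) (auto simp: space_restrict_space hyp_chart_snd)
  have "integrable lborel (\<lambda>y. indicator K y *\<^sub>R (?\<rho> y * ?F y))"
    using \<open>compact K\<close> by (rule borel_integrable_compact) (intro continuous_intros \<rho> cont)
  then have "integrable lborel (\<lambda>y. ?\<rho> y * ?F y)"
    by (rule integrable_discrete_difference[where X = "{b}", THEN iffD1, rotated -1])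
      (auto simp: indicator_def zero)
  then show "integrable hyp_volume F"
    unfolding hyp_volume_def using m
    by (subst integrable_distr_eq[OF chart F], subst integrable_density) auto
  show "(LINT x|hyp_volume. F x) = (LINT y|lborel. ?\<rho> y * ?F y)"
    unfolding hyp_volume_def using m
    by (subst integral_distr[OF chart F], subst integral_density) auto
qed

section \<open>The radial field\<close>

text \<open>This is minus the Minkowski product of \<open>hyp_chart y\<close> and \<open>x0\<close>.
  It is smooth across the pole, so the singularity of the distance enters only through
  \<open>arcosh\<close> and the factor \<open>1 / sinh r\<close>.\<close>

definition cosh_dist :: "real \<times> 'a::euclidean_space \<Rightarrow> 'a \<Rightarrow> real" where
  "cosh_dist x0 y = fst x0 * sqrt (1 + (norm y)\<^sup>2) - y \<bullet> snd x0"

text \<open>The unit radial field \<open>\<partial>/\<partial>r\<close> read in the chart.\<close>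

definition radial_field :: "real \<times> 'a::euclidean_space \<Rightarrow> 'a \<Rightarrow> 'a" where
  "radial_field x0 y =
    (1 / sqrt ((cosh_dist x0 y)\<^sup>2 - 1)) *\<^sub>R (cosh_dist x0 y *\<^sub>R y - snd x0)"

lemma hyp_dist_chart: "hyp_dist (hyp_chart y) x0 = arcosh (cosh_dist x0 y)"
  by (simp add: hyp_dist_def hyp_chart_def cosh_dist_def lorentz_def mult.commute)

lemma fst_hyperboloid_sq: "x0 \<in> hyperboloid \<Longrightarrow> (fst x0)\<^sup>2 = 1 + (norm (snd x0))\<^sup>2"
  unfolding hyperboloid_def lorentz_def power2_norm_eq_inner power2_eq_square[of "fst x0"] by auto

text \<open>With \<open>b = snd x0\<close>, the difference
  \<open>(fst x0 * ?w)^2 - (1 + y \<bullet> b)^2\<close> equals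
  \<open>|y - b|^2 + (|y|^2 |b|^2 - (y \<bullet> b)^2)\<close>, a positive square plus a
  Cauchy-Schwarz defect. Strictness keeps \<open>arcosh\<close> and \<open>1 / sinh r\<close>
  differentiable off the pole.\<close>

lemma cosh_dist_gt_1:
  assumes "x0 \<in> hyperboloid" "y \<noteq> snd x0"
  shows "cosh_dist x0 y > 1"
proof -
  let ?b = "snd x0" and ?w = "sqrt (1 + (norm y)\<^sup>2)"
  have pos: "fst x0 > 0" using assms(1) by (simp add: hyperboloid_def)
  have "(y \<bullet> ?b)\<^sup>2 \<le> (norm y * norm ?b)\<^sup>2"
    using Cauchy_Schwarz_ineq2[of y ?b] by (simp add: abs_le_square_iff[symmetric] abs_mult)
  moreover have "(norm (y - ?b))\<^sup>2 > 0" using assms(2) by simp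
  moreover have "(norm (y - ?b))\<^sup>2 = (norm y)\<^sup>2 + (norm ?b)\<^sup>2 - 2 * (y \<bullet> ?b)"
    by (simp add: power2_norm_eq_inner inner_diff inner_commute)
  moreover have "(fst x0 * ?w)\<^sup>2 = (1 + (norm ?b)\<^sup>2) * (1 + (norm y)\<^sup>2)"
    using fst_hyperboloid_sq[OF assms(1)] by (simp add: power_mult_distrib)
  ultimately have "(1 + y \<bullet> ?b)\<^sup>2 < (fst x0 * ?w)\<^sup>2"
    by (simp add: algebra_simps power2_eq_square)
  then have "1 + y \<bullet> ?b < fst x0 * ?w"
    by (rule power2_less_imp_less) (use pos in simp)
  then show ?thesis by (simp add: cosh_dist_def)
qed

lemma
  assumes "x0 \<in> hyperboloid" "y \<noteq> snd x0"
  shows hyp_dist_pos: "hyp_dist (hyp_chart y) x0 > 0"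
    and cosh_hyp_dist: "cosh (hyp_dist (hyp_chart y) x0) = cosh_dist x0 y"
    and sinh_hyp_dist: "sinh (hyp_dist (hyp_chart y) x0) = sqrt ((cosh_dist x0 y)\<^sup>2 - 1)"
  using cosh_dist_gt_1[OF assms] by (simp_all add: hyp_dist_chart sinh_arcosh_real)

lemma lorentz_comb:
  "lorentz (s *\<^sub>R p + t *\<^sub>R q) (s *\<^sub>R p + t *\<^sub>R q)
    = s\<^sup>2 * lorentz p p + 2 * s * t * lorentz p q + t\<^sup>2 * lorentz q q"
  by (simp add: lorentz_def inner_add inner_commute algebra_simps power2_eq_square)

lemma lorentz_comb_right:
  "lorentz p (s *\<^sub>R q + t *\<^sub>R q') = s * lorentz q p + t * lorentz q' p"
  by (simp add: lorentz_def inner_add inner_commute algebra_simps)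

text \<open>The angle is the part of \<open>hyp_chart y\<close> that is Lorentz orthogonal to
  \<open>x0\<close>, of squared length \<open>cosh^2 r - 1\<close>, divided by its length
  \<open>sinh r\<close>. Hence the polar curve stays on the quadric \<open>lorentz p p = -1\<close>
  and has unit speed.\<close>

lemma
  assumes x0: "x0 \<in> hyperboloid" and y: "y \<noteq> snd x0"
  defines "\<Theta> \<equiv> hyp_angle x0 (hyp_chart y)"
  shows lorentz_hyp_angle: "lorentz x0 \<Theta> = 0" "lorentz \<Theta> \<Theta> = 1"
proof -
  let ?x = "hyp_chart y" and ?c = "cosh_dist x0 y" and ?s = "sqrt ((cosh_dist x0 y)\<^sup>2 - 1)"
  have \<Theta>: "\<Theta> = (1 / ?s) *\<^sub>R ?x + (- (?c / ?s)) *\<^sub>R x0"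
    unfolding \<Theta>_def hyp_angle_def cosh_hyp_dist[OF x0 y] sinh_hyp_dist[OF x0 y]
    by (simp add: algebra_simps)
  have x: "lorentz ?x ?x = -1" and l0: "lorentz x0 x0 = -1"
    using hyp_chart_in_hyperboloid[of y] x0 by (auto simp: hyperboloid_def)
  have xx0: "lorentz ?x x0 = - ?c"
    by (simp add: lorentz_def hyp_chart_def cosh_dist_def)
  have "?c\<^sup>2 > 1" using cosh_dist_gt_1[OF x0 y] by simp
  then have s: "?s > 0" "?s\<^sup>2 = ?c\<^sup>2 - 1" by auto
  show "lorentz x0 \<Theta> = 0" unfolding \<Theta> lorentz_comb_right xx0 l0 by simp
  have "lorentz \<Theta> \<Theta> = (?c\<^sup>2 - 1) / ?s\<^sup>2"
    unfolding \<Theta> lorentz_comb x xx0 l0 by (simp add: power2_eq_square diff_divide_distrib)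
  then show "lorentz \<Theta> \<Theta> = 1" using s by simp
qed

lemma has_vector_derivative_hyp_polar:
  "((\<lambda>s. hyp_polar x0 s \<Theta>) has_vector_derivative (sinh s *\<^sub>R x0 + cosh s *\<^sub>R \<Theta>)) (at s)"
  unfolding hyp_polar_def
  by (auto intro!: derivative_eq_intros simp: has_real_derivative_iff_has_vector_derivative[symmetric])

lemma hyp_polar_hyp_angle:
  assumes "x0 \<in> hyperboloid" "y \<noteq> snd x0"
  shows "hyp_polar x0 (hyp_dist (hyp_chart y) x0) (hyp_angle x0 (hyp_chart y)) = hyp_chart y"
  using hyp_dist_pos[OF assms] by (simp add: hyp_polar_def hyp_angle_def)

lemma hyp_normsq_radial_grad:
  assumes "x0 \<in> hyperboloid" "y \<noteq> snd x0"
  shows "hyp_normsq (radial_grad x0 g (hyp_chart y)) = (radial_deriv x0 g (hyp_chart y))\<^sup>2"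
proof -
  let ?r = "hyp_dist (hyp_chart y) x0"
  have l0: "lorentz x0 x0 = -1" using assms(1) by (simp add: hyperboloid_def)
  have "lorentz (radial_unit x0 (hyp_chart y)) (radial_unit x0 (hyp_chart y)) = (cosh ?r)\<^sup>2 - (sinh ?r)\<^sup>2"
    unfolding radial_unit_def vector_derivative_at[OF has_vector_derivative_hyp_polar] lorentz_comb
    by (simp add: lorentz_hyp_angle[OF assms] l0)
  moreover have "hyp_normsq (k *\<^sub>R v) = k\<^sup>2 * lorentz v v" for k and v :: "real \<times> 'a"
    by (simp add: hyp_normsq_def lorentz_def power2_eq_square algebra_simps)
  ultimately show ?thesis by (simp add: radial_grad_def cosh_square_eq)
qed

text \<open>Near \<open>s = r\<close> the curve \<^const>\<open>hyp_polar\<close> stays on the hyperboloid, so only the values of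
  \<open>g\<close> there matter.\<close>

lemma radial_deriv_chart:
  assumes x0: "x0 \<in> hyperboloid" and y: "y \<noteq> snd x0"
    and D: "((\<lambda>z. g (hyp_chart z)) has_derivative D) (at y)"
  shows "radial_deriv x0 g (hyp_chart y) = D (radial_field x0 y)"
proof -
  let ?r = "hyp_dist (hyp_chart y) x0" and ?\<Theta> = "hyp_angle x0 (hyp_chart y)"
  let ?p = "\<lambda>s. hyp_polar x0 s ?\<Theta>"
  have l0: "lorentz x0 x0 = -1" using x0 by (simp add: hyperboloid_def)
  have pr: "?p ?r = hyp_chart y" by (rule hyp_polar_hyp_angle[OF x0 y])
  have cont: "isCont (\<lambda>s. fst (?p s)) ?r"
    unfolding hyp_polar_def by (intro continuous_intros)
  have pos: "fst (?p ?r) > 0"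
    unfolding pr using hyp_chart_in_hyperboloid[of y] by (simp add: hyperboloid_def)
  \<comment> \<open>The quadric \<open>lorentz p p = -1\<close> has two sheets; continuity keeps the
    curve on the upper one near \<open>?r\<close>.\<close>
  have "eventually (\<lambda>s. fst (?p s) > 0) (nhds ?r)"
  proof (rule order_tendstoD(1)[OF _ pos])
    show "((\<lambda>s. fst (?p s)) \<longlongrightarrow> fst (?p ?r)) (nhds ?r)"
      using cont tendsto_at_iff_tendsto_nhds[where g = "\<lambda>s. fst (?p s)" and l = ?r]
      unfolding isCont_def by blast
  qed
  then have ev: "eventually (\<lambda>s. g (?p s) = g (hyp_chart (snd (?p s)))) (nhds ?r)"
  proof eventually_elim
    case (elim s)
    have "lorentz (?p s) (?p s) = -1"
      unfolding hyp_polar_def lorentz_comb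
      by (simp add: lorentz_hyp_angle[OF x0 y] l0 cosh_square_eq)
    then show ?case using elim by (simp add: hyp_chart_snd hyperboloid_def)
  qed
  have s: "sinh ?r > 0" using hyp_dist_pos[OF x0 y] by simp
  \<comment> \<open>The velocity at \<open>?r\<close> is \<open>sinh r x0 + cosh r \<Theta>\<close>.
    Substituting \<open>\<Theta> = (x - cosh r x0) / sinh r\<close> gives
    \<open>(cosh r x - x0) / sinh r\<close>, whose space component is the formula for
    \<open>radial_field\<close>.\<close>
  have "sinh ?r *\<^sub>R snd x0 + cosh ?r *\<^sub>R snd ?\<Theta>
      = (1 / sinh ?r) *\<^sub>R (cosh ?r *\<^sub>R y - ((cosh ?r)\<^sup>2 - (sinh ?r)\<^sup>2) *\<^sub>R snd x0)"
    using s by (simp add: hyp_angle_def algebra_simps power2_eq_square)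
  also have "\<dots> = radial_field x0 y"
  proof -
    have 1: "(cosh ?r)\<^sup>2 - (sinh ?r)\<^sup>2 = 1" by (simp add: cosh_square_eq)
    show ?thesis
      unfolding 1 unfolding radial_field_def cosh_hyp_dist[OF x0 y] sinh_hyp_dist[OF x0 y] by simp
  qed
  finally have "((\<lambda>s. snd (?p s)) has_vector_derivative radial_field x0 y) (at ?r)"
    using bounded_linear.has_vector_derivative[OF bounded_linear_snd
        has_vector_derivative_hyp_polar[of x0 ?\<Theta> ?r]] by simp
  then have "((\<lambda>s. snd (?p s)) has_derivative (\<lambda>t. t *\<^sub>R radial_field x0 y)) (at ?r)"
    by (simp add: has_vector_derivative_def)
  from has_derivative_compose[OF this] D
  have "((\<lambda>s. g (hyp_chart (snd (?p s)))) has_derivative (\<lambda>t. D (t *\<^sub>R radial_field x0 y))) (at ?r)"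
    by (simp add: pr)
  then have "((\<lambda>s. g (hyp_chart (snd (?p s)))) has_real_derivative D (radial_field x0 y)) (at ?r)"
    unfolding has_field_derivative_def
    by (rule has_derivative_eq_rhs) (auto simp: linear_cmul[OF has_derivative_linear[OF D]])
  then show ?thesis
    unfolding radial_deriv_def deriv_cong_ev[OF ev refl] by (rule DERIV_imp_deriv)
qed

section \<open>Regularity of the distance and of the radial field\<close>

lemma has_derivative_sqrt_norm:
  "((\<lambda>y::'a::euclidean_space. sqrt (1 + (norm y)\<^sup>2)) has_derivative
    (\<lambda>v. (y \<bullet> v) / sqrt (1 + (norm y)\<^sup>2))) (at y)"
proof -
  have "1 + y \<bullet> y > 0" by (simp add: add_pos_nonneg)
  then show ?thesis
    unfolding power2_norm_eq_inner
    by (auto intro!: derivative_eq_intros simp: inner_commute divide_simps)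
qed

lemma has_derivative_cosh_dist:
  "(cosh_dist x0 has_derivative (\<lambda>v. fst x0 * (y \<bullet> v) / sqrt (1 + (norm y)\<^sup>2) - v \<bullet> snd x0)) (at y)"
  unfolding cosh_dist_def[abs_def]
  by (rule has_derivative_eq_rhs[OF has_derivative_diff[OF
        has_derivative_mult_right[OF has_derivative_sqrt_norm]
        has_derivative_inner_left[OF has_derivative_ident]]])
    simp

lemma sqrt_norm_pos: "sqrt (1 + (norm y)\<^sup>2) > 0"
  by (simp add: add_pos_nonneg)

lemma C1_on_cosh_dist: "C1_on S (cosh_dist x0)"
proof (rule C1_onI[OF has_derivative_cosh_dist])
  show "continuous_on S (\<lambda>y. fst x0 * (y \<bullet> v) / sqrt (1 + (norm y)\<^sup>2) - v \<bullet> snd x0)" for v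
    by (intro continuous_intros ballI less_imp_neq[symmetric] sqrt_norm_pos)
qed

lemma DERIV_inverse_sqrt:
  fixes t :: real
  assumes "t > 1"
  shows "((\<lambda>t. 1 / sqrt (t\<^sup>2 - 1)) has_real_derivative - t / (sqrt (t\<^sup>2 - 1)) ^ 3) (at t)"
proof -
  have "t\<^sup>2 - 1 > 0" using assms by simp
  then show ?thesis
    by (auto intro!: derivative_eq_intros simp: field_simps power3_eq_cube)
qed

lemma C1_on_inverse_sinh_dist:
  assumes "x0 \<in> hyperboloid"
  shows "C1_on (- {snd x0}) (\<lambda>y. 1 / sqrt ((cosh_dist x0 y)\<^sup>2 - 1))"
proof (rule C1_on_compose[OF C1_on_cosh_dist _ DERIV_inverse_sqrt])
  show "continuous_on {1<..} (\<lambda>t::real. - t / (sqrt (t\<^sup>2 - 1)) ^ 3)"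
    by (intro continuous_intros) (auto simp: power2_eq_1_iff)
qed (use cosh_dist_gt_1[OF assms] in auto)

lemma C1_on_hyp_dist:
  assumes "x0 \<in> hyperboloid"
  shows "C1_on (- {snd x0}) (\<lambda>y. hyp_dist (hyp_chart y) x0)"
  unfolding hyp_dist_chart
proof (rule C1_on_compose[OF C1_on_cosh_dist _ arcosh_real_has_field_derivative])
  show "continuous_on {1<..} (\<lambda>t::real. 1 / sqrt (t\<^sup>2 - 1))"
    by (intro continuous_intros) (auto simp: power2_eq_1_iff)
qed (use cosh_dist_gt_1[OF assms] in auto)

lemma C1_on_radial_field:
  assumes "x0 \<in> hyperboloid"
  shows "C1_on (- {snd x0}) (\<lambda>y. radial_field x0 y \<bullet> j)"
proof -
  have "C1_on (- {snd x0})
    (\<lambda>y. 1 / sqrt ((cosh_dist x0 y)\<^sup>2 - 1) * (cosh_dist x0 y * (y \<bullet> j) + - (snd x0 \<bullet> j)))"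
    by (intro C1_on_mult C1_on_add C1_on_inverse_sinh_dist assms C1_on_cosh_dist C1_on_inner C1_on_const)
  then show ?thesis by (simp add: radial_field_def inner_diff_left)
qed

section \<open>Calculus of radial derivatives\<close>

lemma linear_eq_sum_Basis:
  fixes L :: "'a::euclidean_space \<Rightarrow> real"
  assumes "linear L"
  shows "(\<Sum>i\<in>Basis. L i * (y \<bullet> i)) = L y"
proof -
  have "L y = L (\<Sum>i\<in>Basis. (y \<bullet> i) *\<^sub>R i)" by (simp add: euclidean_representation)
  also have "\<dots> = (\<Sum>i\<in>Basis. L i * (y \<bullet> i))"
    by (simp add: linear_sum[OF assms] linear_cmul[OF assms] mult.commute)
  finally show ?thesis by simp
qed

text \<open>\<open>C1_on\<close> controls derivatives in fixed directions, while the radial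
  direction moves with \<open>y\<close>. The expansion leaves partial derivatives with C1
  coefficients, from which the regularity of \<open>radial_deriv\<close> is read off.\<close>

lemma radial_deriv_eq_sum:
  assumes x0: "x0 \<in> hyperboloid" and y: "y \<noteq> snd x0"
    and g: "C1_on (- {snd x0}) (\<lambda>y. g (hyp_chart y))"
  shows "radial_deriv x0 g (hyp_chart y) =
    (\<Sum>j\<in>Basis. frechet_derivative (\<lambda>y. g (hyp_chart y)) (at y) j * (radial_field x0 y \<bullet> j))"
proof -
  have D: "((\<lambda>y. g (hyp_chart y)) has_derivative frechet_derivative (\<lambda>y. g (hyp_chart y)) (at y)) (at y)"
    by (rule C1_on_has_derivative[OF g]) (use y in simp)
  show ?thesis
    by (simp add: radial_deriv_chart[OF x0 y D] linear_eq_sum_Basis[OF has_derivative_linear[OF D]])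
qed

lemma continuous_on_radial_deriv:
  assumes x0: "x0 \<in> hyperboloid" and g: "C1_on (- {snd x0}) (\<lambda>y. g (hyp_chart y))"
  shows "continuous_on (- {snd x0}) (\<lambda>y. radial_deriv x0 g (hyp_chart y))"
proof -
  have "continuous_on (- {snd x0}) (\<lambda>y. \<Sum>j\<in>Basis.
      frechet_derivative (\<lambda>y. g (hyp_chart y)) (at y) j * (radial_field x0 y \<bullet> j))"
    by (intro continuous_intros C1_on_continuous_derivative[OF g]
        C1_on_continuous[OF C1_on_radial_field[OF x0]])
  then show ?thesis
    by (rule continuous_on_cong[THEN iffD1, rotated -1]) (auto simp: radial_deriv_eq_sum[OF x0 _ g])
qed

text \<open>The pole is excluded in the vanishing hypothesis because \<open>g\<close> may itself be
  a radial derivative, with an arbitrary value there.\<close>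

lemma radial_deriv_eq_0:
  assumes x0: "x0 \<in> hyperboloid" and y: "y \<noteq> snd x0" and "open U" "y \<in> U"
    and zero: "\<And>z. z \<in> U \<Longrightarrow> z \<noteq> snd x0 \<Longrightarrow> g (hyp_chart z) = 0"
  shows "radial_deriv x0 g (hyp_chart y) = 0"
proof -
  have "((\<lambda>z. g (hyp_chart z)) has_derivative (\<lambda>_. 0)) (at y)"
    by (rule has_derivative_transform_within_open[OF has_derivative_const[of 0], of "U - {snd x0}"])
      (use y \<open>open U\<close> \<open>y \<in> U\<close> zero in auto)
  from radial_deriv_chart[OF x0 y this] show ?thesis .
qed

lemma radial_deriv_mult:
  assumes x0: "x0 \<in> hyperboloid" and y: "y \<noteq> snd x0"
    and g: "C1_on (- {snd x0}) (\<lambda>y. g (hyp_chart y))"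
    and h: "C1_on (- {snd x0}) (\<lambda>y. h (hyp_chart y))"
  shows "radial_deriv x0 (\<lambda>x. g x * h x) (hyp_chart y) =
    radial_deriv x0 g (hyp_chart y) * h (hyp_chart y) + g (hyp_chart y) * radial_deriv x0 h (hyp_chart y)"
proof -
  have Y: "y \<in> - {snd x0}" using y by simp
  show ?thesis
    unfolding radial_deriv_chart[OF x0 y C1_on_has_derivative[OF g Y]]
      radial_deriv_chart[OF x0 y C1_on_has_derivative[OF h Y]]
    using radial_deriv_chart[OF x0 y has_derivative_mult[OF C1_on_has_derivative[OF g Y]
          C1_on_has_derivative[OF h Y]]]
    by simp
qed

text \<open>Off the pole \<open>Y\<close> is \<open>sinh r\<close> times the radial field, and
  \<open>fst x0 * (y \<bullet> v) / w - v \<bullet> snd x0\<close> is the derivative of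
  \<open>cosh_dist\<close> in direction \<open>v\<close>. The first identity thus says that
  \<open>cosh r\<close> has radial derivative \<open>sinh r\<close>; the second serves to
  differentiate the density \<open>1 / w\<close> along \<open>Y\<close>; the third enters the
  divergence of \<open>Y\<close>, which is \<open>DIM('a) * c\<close> plus the derivative of
  \<open>cosh_dist\<close> in direction \<open>y\<close>.\<close>

lemma cosh_dist_identities:
  fixes y :: "'a::euclidean_space"
  assumes x0: "x0 \<in> hyperboloid"
  defines "c \<equiv> cosh_dist x0 y" and "w \<equiv> sqrt (1 + (norm y)\<^sup>2)"
  defines "Y \<equiv> c *\<^sub>R y - snd x0"
  shows "fst x0 * (y \<bullet> Y) / w - Y \<bullet> snd x0 = c\<^sup>2 - 1"
    and "y \<bullet> Y = w\<^sup>2 * c - fst x0 * w"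
    and "fst x0 * (y \<bullet> y) / w - y \<bullet> snd x0 = c - fst x0 / w"
proof -
  have w: "w > 0" "w\<^sup>2 = 1 + y \<bullet> y"
    unfolding w_def by (simp_all add: add_pos_nonneg power2_norm_eq_inner)
  have b: "snd x0 \<bullet> snd x0 = (fst x0)\<^sup>2 - 1"
    using fst_hyperboloid_sq[OF x0] by (simp add: power2_norm_eq_inner)
  have c: "y \<bullet> snd x0 = fst x0 * w - c" unfolding c_def w_def cosh_dist_def by simp
  have yy: "y \<bullet> y = w\<^sup>2 - 1" using w by simp
  show yY: "y \<bullet> Y = w\<^sup>2 * c - fst x0 * w"
    unfolding Y_def by (simp add: inner_diff c yy algebra_simps)
  show "fst x0 * (y \<bullet> Y) / w - Y \<bullet> snd x0 = c\<^sup>2 - 1"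
    unfolding yY using w(1) unfolding Y_def
    by (simp add: inner_diff c b field_simps power2_eq_square)
  show "fst x0 * (y \<bullet> y) / w - y \<bullet> snd x0 = c - fst x0 / w"
    unfolding yy c using w(1) by (simp add: field_simps power2_eq_square)
qed

text \<open>The distance has radial derivative 1: \<open>cosh r\<close> changes at rate
  \<open>sinh r\<close>, and \<open>arcosh\<close> contributes \<open>1 / sinh r\<close>.\<close>

lemma radial_deriv_compose_hyp_dist:
  assumes x0: "x0 \<in> hyperboloid" and y: "y \<noteq> snd x0"
    and q: "(q has_real_derivative q') (at (hyp_dist (hyp_chart y) x0))"
  shows "radial_deriv x0 (\<lambda>x. q (hyp_dist x x0)) (hyp_chart y) = q'"
proof -
  let ?c = "cosh_dist x0 y" and ?w = "sqrt (1 + (norm y)\<^sup>2)"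
  let ?dc = "\<lambda>v. fst x0 * (y \<bullet> v) / ?w - v \<bullet> snd x0"
  let ?s = "sqrt (?c\<^sup>2 - 1)"
  have c: "?c > 1" by (rule cosh_dist_gt_1[OF x0 y])
  then have "?c\<^sup>2 > 1" by simp
  then have s: "?s > 0" "?s * ?s = ?c\<^sup>2 - 1" by auto
  have "((\<lambda>z. hyp_dist (hyp_chart z) x0) has_derivative (\<lambda>v. ?dc v * (1 / ?s))) (at y)"
    unfolding hyp_dist_chart
    by (rule DERIV_compose_FDERIV[OF arcosh_real_has_field_derivative[OF c] has_derivative_cosh_dist])
  from radial_deriv_chart[OF x0 y DERIV_compose_FDERIV[OF q this]]
  have "radial_deriv x0 (\<lambda>x. q (hyp_dist x x0)) (hyp_chart y) = ?dc (radial_field x0 y) * (1 / ?s) * q'"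
    by simp
  also have "?dc (radial_field x0 y) = (1 / ?s) * ?dc (?c *\<^sub>R y - snd x0)"
    unfolding radial_field_def by (simp add: right_diff_distrib)
  also have "\<dots> = (1 / ?s) * (?c\<^sup>2 - 1)"
    by (simp only: cosh_dist_identities(1)[OF x0])
  also have "(1 / ?s) * (?c\<^sup>2 - 1) * (1 / ?s) * q' = (1 / ?s) * (?s * ?s) * (1 / ?s) * q'"
    by (simp only: s(2))
  also have "\<dots> = q'" using s(1) by simp
  finally show ?thesis .
qed

text \<open>Up to the density, the integrand is the Euclidean divergence of \<open>g\<close> times the density times
  \<^const>\<open>radial_field\<close>: in hyperbolic space the unit radial field has divergence
  \<open>(N - 1) coth r\<close>.\<close>

lemma integral_hyp_volume_radial_divergence:
  fixes g :: "real \<times> 'a::euclidean_space \<Rightarrow> real"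
  assumes x0: "x0 \<in> hyperboloid" and g: "C1_on (- {snd x0}) (\<lambda>y. g (hyp_chart y))"
    and K: "compact K" "snd x0 \<notin> K"
    and zero: "\<And>y. y \<notin> K \<Longrightarrow> y \<noteq> snd x0 \<Longrightarrow> g (hyp_chart y) = 0"
  shows "integrable hyp_volume (\<lambda>x. radial_deriv x0 g x
            + (real DIM('a) - 1) * coth (hyp_dist x x0) * g x)" (is "integrable _ ?F")
    and "(LINT x|hyp_volume. radial_deriv x0 g x
            + (real DIM('a) - 1) * coth (hyp_dist x x0) * g x) = 0"
proof -
  let ?S = "- {snd x0}" and ?p = "\<lambda>y. g (hyp_chart y)" and ?c = "cosh_dist x0"
  let ?w = "\<lambda>y::'a. sqrt (1 + (norm y)\<^sup>2)" and ?r = "\<lambda>y. hyp_dist (hyp_chart y) x0"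
  let ?Y = "\<lambda>y. ?c y *\<^sub>R y - snd x0"
  let ?\<kappa> = "\<lambda>y. 1 / sqrt ((?c y)\<^sup>2 - 1)"
  \<comment> \<open>Component \<open>i\<close> of \<open>g\<close> times the density times the
    radial field, arranged as the scalar \<open>g * ?\<kappa> / w\<close>, with
    \<open>?\<kappa> = 1 / sinh r\<close>, times the field \<open>?Y\<close>, whose divergence is
    elementary.\<close>
  define G where "G i y = ?p y * ?\<kappa> y * (1 / ?w y) * (?c y * (y \<bullet> i) + - (snd x0 \<bullet> i))" for i y
  define G0 where "G0 i y = (if y \<in> ?S then G i y else 0)" for i y
  have KS: "K \<subseteq> ?S" using K(2) by auto
  have S: "open ?S" by auto
  have Kc: "open (- K)" using K(1) by (simp add: compact_imp_closed open_Compl)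
  have \<rho>: "((\<lambda>y. 1 / ?w y) has_derivative (\<lambda>v. - (y \<bullet> v) / ?w y ^ 3)) (at y)" for y
  proof -
    have "((\<lambda>t. 1 / t) has_real_derivative - 1 / (?w y)\<^sup>2) (at (?w y))"
      using sqrt_norm_pos[of y] by (auto intro!: derivative_eq_intros simp: power2_eq_square)
    from DERIV_compose_FDERIV[OF this has_derivative_sqrt_norm] show ?thesis
      by (rule has_derivative_eq_rhs) (simp add: fun_eq_iff power2_eq_square power3_eq_cube mult.commute)
  qed
  have C1\<rho>: "C1_on ?S (\<lambda>y. 1 / ?w y)"
    by (rule C1_onI[OF \<rho>])
      (intro continuous_intros ballI power_not_zero less_imp_neq[symmetric] sqrt_norm_pos)
  have "C1_on ?S (G i)" for i
    unfolding G_def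
    by (intro C1_on_mult C1_on_add g C1\<rho> C1_on_inverse_sinh_dist x0 C1_on_cosh_dist C1_on_inner C1_on_const)
  then have C1G0: "C1_on UNIV (G0 i)" for i
    unfolding G0_def by (rule C1_on_extend_zero[OF _ S K(1) KS]) (auto simp: G_def zero)
  have G0z: "G0 i y = 0" if "y \<notin> K" for i y
    using that zero by (auto simp: G0_def G_def)
  have div: "(\<Sum>i\<in>Basis. frechet_derivative (G0 i) (at y) i) = 1 / ?w y * ?F (hyp_chart y)"
    if y: "y \<noteq> snd x0" for y
  proof -
    define p' where "p' = frechet_derivative ?p (at y)"
    define c w \<kappa> where "c = ?c y" and "w = ?w y" and "\<kappa> = ?\<kappa> y"
    define dc where "dc v = fst x0 * (y \<bullet> v) / w - v \<bullet> snd x0" for v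
    have p': "(?p has_derivative p') (at y)"
      unfolding p'_def by (rule C1_on_has_derivative[OF g]) (use y in simp)
    have c: "c > 1" unfolding c_def by (rule cosh_dist_gt_1[OF x0 y])
    then have "c\<^sup>2 > 1" by simp
    then have \<kappa>: "\<kappa> > 0" "\<kappa>\<^sup>2 * (c\<^sup>2 - 1) = 1"
      unfolding \<kappa>_def c_def[symmetric] by (auto simp: power_divide)
    have w: "w > 0" unfolding w_def by (rule sqrt_norm_pos)
    have dc: "(?c has_derivative dc) (at y)"
      unfolding dc_def[abs_def] w_def by (rule has_derivative_cosh_dist)
    have dk: "(?\<kappa> has_derivative (\<lambda>v. dc v * (- c * \<kappa> ^ 3))) (at y)"
      using DERIV_compose_FDERIV[OF DERIV_inverse_sqrt dc] c
      unfolding c_def \<kappa>_def by (simp add: power_divide)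
    have dw: "((\<lambda>y. 1 / ?w y) has_derivative (\<lambda>v. - (y \<bullet> v) / w ^ 3)) (at y)"
      unfolding w_def by (rule \<rho>)
    \<comment> \<open>The derivative of the scalar in front of \<open>?Y\<close>: the summands
      differentiate \<open>g\<close>, \<open>1 / sinh r\<close> and the density in turn. By the
      product rule the divergence is \<open>L (?Y y)\<close> plus the scalar times the divergence of
      \<open>?Y\<close>.\<close>
    define L where "L v = p' v * \<kappa> * (1 / w) + ?p y * (dc v * (- c * \<kappa> ^ 3)) * (1 / w)
      + ?p y * \<kappa> * (- (y \<bullet> v) / w ^ 3)" for v
    have q: "((\<lambda>y. ?p y * ?\<kappa> y * (1 / ?w y)) has_derivative L) (at y)"
      by (rule has_derivative_eq_rhs[OF has_derivative_mult[OF has_derivative_mult[OF p' dk] dw]])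
        (simp only: L_def fun_eq_iff flip: \<kappa>_def w_def, simp add: algebra_simps)
    have fr: "frechet_derivative (G0 i) (at y) i =
        L i * (?Y y \<bullet> i) + ?p y * \<kappa> * (1 / w) * (dc i * (y \<bullet> i) + c)" if "i \<in> Basis" for i
    proof -
      have "((\<lambda>y. ?c y * (y \<bullet> i) + - (snd x0 \<bullet> i)) has_derivative (\<lambda>v. c * (v \<bullet> i) + dc v * (y \<bullet> i))) (at y)"
        unfolding c_def by (auto intro!: derivative_eq_intros dc)
      from has_derivative_mult[OF q this]
      have "(G i has_derivative (\<lambda>v. ?p y * \<kappa> * (1 / w) * (c * (v \<bullet> i) + dc v * (y \<bullet> i))
          + L v * (c * (y \<bullet> i) + - (snd x0 \<bullet> i)))) (at y)"
        unfolding G_def[abs_def] c_def w_def \<kappa>_def .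
      then have "(G0 i has_derivative (\<lambda>v. ?p y * \<kappa> * (1 / w) * (c * (v \<bullet> i) + dc v * (y \<bullet> i))
          + L v * (c * (y \<bullet> i) + - (snd x0 \<bullet> i)))) (at y)"
        by (rule has_derivative_transform_within_open[OF _ S]) (use y in \<open>auto simp: G0_def\<close>)
      from frechet_derivative_at[OF this, symmetric] show ?thesis
        using that by (simp add: inner_diff_left c_def algebra_simps)
    qed
    have "(\<Sum>i\<in>Basis. frechet_derivative (G0 i) (at y) i) =
        (\<Sum>i\<in>Basis. L i * (?Y y \<bullet> i)) + ?p y * \<kappa> * (1 / w) * ((\<Sum>i\<in>Basis. dc i * (y \<bullet> i)) + real DIM('a) * c)"
      by (simp add: fr sum.distrib sum_distrib_left distrib_left)
    also have "\<dots> = L (?Y y) + ?p y * \<kappa> * (1 / w) * (dc y + real DIM('a) * c)"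
      using linear_eq_sum_Basis[OF has_derivative_linear[OF q]]
        linear_eq_sum_Basis[OF has_derivative_linear[OF dc]] by simp
    also have "L (?Y y) = 1 / w * (\<kappa> * p' (?Y y)) - 1 / w * ?p y * c * \<kappa> * (\<kappa>\<^sup>2 * (c\<^sup>2 - 1))
        + ?p y * \<kappa> * (1 / w) * (fst x0 / w - c)"
    proof -
      have 1: "dc (?Y y) = c\<^sup>2 - 1"
        unfolding dc_def c_def w_def by (rule cosh_dist_identities(1)[OF x0])
      have 2: "y \<bullet> ?Y y = w\<^sup>2 * c - fst x0 * w"
        unfolding c_def w_def by (rule cosh_dist_identities(2)[OF x0])
      have 3: "- (y \<bullet> ?Y y) / w ^ 3 = (1 / w) * (fst x0 / w - c)"
        unfolding 2 using w by (simp add: field_simps power2_eq_square power3_eq_cube)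
      show ?thesis unfolding L_def 1 3 by (simp add: power2_eq_square power3_eq_cube mult_ac)
    qed
    also have "dc y = c - fst x0 / w"
      unfolding dc_def c_def w_def by (rule cosh_dist_identities(3)[OF x0])
    also have "\<kappa> * p' (?Y y) = radial_deriv x0 g (hyp_chart y)"
      unfolding radial_deriv_chart[OF x0 y p'] radial_field_def \<kappa>_def
      by (simp add: linear_cmul[OF has_derivative_linear[OF p']])
    \<comment> \<open>The terms in \<open>fst x0 / w\<close>, from the density and from the
      divergence of \<open>?Y\<close>, cancel. Among the multiples of \<open>c\<close>, the
      divergence of \<open>?Y\<close> gives \<open>DIM('a) + 1\<close>, while the density and
      \<open>1 / sinh r\<close> give \<open>-1\<close> each, which leaves
      \<open>DIM('a) - 1\<close>.\<close>
    also have "1 / w * radial_deriv x0 g (hyp_chart y) - 1 / w * ?p y * c * \<kappa> * (\<kappa>\<^sup>2 * (c\<^sup>2 - 1))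
        + ?p y * \<kappa> * (1 / w) * (fst x0 / w - c)
        + ?p y * \<kappa> * (1 / w) * (c - fst x0 / w + real DIM('a) * c)
      = 1 / w * (radial_deriv x0 g (hyp_chart y) + (real DIM('a) - 1) * (c * \<kappa>) * ?p y)"
      unfolding \<kappa>(2) by (simp add: algebra_simps diff_divide_distrib add_divide_distrib)
    also have "c * \<kappa> = coth (?r y)"
      unfolding coth_def cosh_hyp_dist[OF x0 y] sinh_hyp_dist[OF x0 y] c_def \<kappa>_def by simp
    finally show ?thesis unfolding w_def .
  qed
  have F0: "?F (hyp_chart y) = 0" if "y \<notin> K" "y \<noteq> snd x0" for y
    using radial_deriv_eq_0[OF x0 that(2) Kc, of g] that zero by auto
  have "continuous_on ?S (\<lambda>y. ?F (hyp_chart y))"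
    unfolding coth_def
    by (intro continuous_intros continuous_on_radial_deriv x0 g C1_on_continuous[OF g]
        C1_on_continuous[OF C1_on_hyp_dist[OF x0]])
      (use hyp_dist_pos[OF x0] in force)
  then have cont: "continuous_on K (\<lambda>y. ?F (hyp_chart y))"
    by (rule continuous_on_subset[OF _ KS])
  show "integrable hyp_volume ?F"
    using integral_hyp_volume(1)[OF K(1) cont F0] .
  have "(LINT x|hyp_volume. ?F x) = (LINT y|lborel. 1 / ?w y * ?F (hyp_chart y))"
    using integral_hyp_volume(2)[OF K(1) cont F0] .
  also have "\<dots> = (LINT y|lborel. (\<Sum>i\<in>Basis. frechet_derivative (G0 i) (at y) i))"
    by (rule integral_discrete_difference[where X = "{snd x0}"]) (auto simp: div)
  also have "\<dots> = (\<Sum>i\<in>Basis. LINT y|lborel. frechet_derivative (G0 i) (at y) i)"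
    by (rule Bochner_Integration.integral_sum) (rule integral_derivative_eq_0(1)[OF C1G0 K(1) G0z])
  also have "\<dots> = 0"
    by (simp add: integral_derivative_eq_0(2)[OF C1G0 K(1) G0z])
  finally show "(LINT x|hyp_volume. ?F x) = 0" .
qed

section \<open>The integral identity\<close>

lemma continuous_on_radial_compose:
  assumes "x0 \<in> hyperboloid" "continuous_on {0<..} q"
  shows "continuous_on (- {snd x0}) (\<lambda>y. q (hyp_dist (hyp_chart y) x0))"
  using hyp_dist_pos[OF assms(1)]
  by (intro continuous_on_compose2[OF assms(2) C1_on_continuous[OF C1_on_hyp_dist[OF assms(1)]]]) auto

lemma C1_on_radial_compose:
  assumes "x0 \<in> hyperboloid" "\<And>s. 0 < s \<Longrightarrow> (q has_real_derivative q' s) (at s)"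
    "continuous_on {0<..} q'"
  shows "C1_on (- {snd x0}) (\<lambda>y. q (hyp_dist (hyp_chart y) x0))"
  by (rule C1_on_compose[OF C1_on_hyp_dist[OF assms(1)] _ assms(2) assms(3)])
    (use hyp_dist_pos[OF assms(1)] in auto)

lemma C1_on_radial_deriv:
  fixes g :: "real \<times> 'a::euclidean_space \<Rightarrow> real"
  assumes x0: "x0 \<in> hyperboloid" and g: "C_infinity (\<lambda>y. g (hyp_chart y))"
  shows "C1_on (- {snd x0}) (\<lambda>y. radial_deriv x0 g (hyp_chart y))"
proof -
  have "C1_on (- {snd x0}) (\<lambda>y. \<Sum>j\<in>Basis.
      frechet_derivative (\<lambda>y. g (hyp_chart y)) (at y) j * (radial_field x0 y \<bullet> j))"
    by (intro C1_on_sum C1_on_mult C_infinity_C1_on C_infinity_derivative g C1_on_radial_field x0)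
      simp
  then show ?thesis
    by (rule C1_on_cong) (auto simp: radial_deriv_eq_sum[OF x0 _ C_infinity_C1_on[OF g]])
qed

text \<open>The Bessel hypothesis gives regularity of \<open>s^(N - 1) V\<close>, but
  \<open>V'\<close> itself appears in the identity; the power is nonzero for \<open>s > 0\<close>
  and can be divided out. With \<open>n = 0\<close> the lemma just unpacks
  \<open>C1_differentiable_on\<close>, which is how it serves for \<open>f\<close>.\<close>

lemma C1_cancel_power:
  fixes V :: "real \<Rightarrow> real"
  assumes "(\<lambda>s. s ^ n * V s) C1_differentiable_on {0<..}"
  obtains V' where "\<And>s. s > 0 \<Longrightarrow> (V has_real_derivative V' s) (at s)" "continuous_on {0<..} V'"
proof -
  obtain P' where P': "\<And>s. s > 0 \<Longrightarrow> ((\<lambda>s. s ^ n * V s) has_real_derivative P' s) (at s)"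
    and cont: "continuous_on {0<..} P'"
    using assms unfolding C1_differentiable_on_def
    by (auto simp: has_real_derivative_iff_has_vector_derivative)
  have D: "(V has_real_derivative
      (P' s * s ^ n - (s ^ n * V s) * (real n * s ^ (n - 1))) / (s ^ n * s ^ n)) (at s)" if "s > 0" for s
  proof -
    have "((\<lambda>s. (s ^ n * V s) / s ^ n) has_real_derivative
        (P' s * s ^ n - (s ^ n * V s) * (real n * s ^ (n - 1))) / (s ^ n * s ^ n)) (at s)"
      using that DERIV_pow[of n s] by (intro DERIV_divide P') auto
    then show ?thesis
      by (rule has_field_derivative_transform_within_open[of _ _ _ "{0<..}"]) (use that in auto)
  qed
  have "continuous_on {0<..} V"
    using D by (force intro!: continuous_at_imp_continuous_on DERIV_isCont)
  then show thesis
    by (intro that[OF D] continuous_intros cont) auto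
qed

text \<open>Pointwise identities between radial quantities hold off the pole only. Taking
  \<open>K\<close> empty in the transfer to the chart disposes of that null point, measurability
  included.\<close>

lemma integral_hyp_volume_eq_0:
  fixes F :: "real \<times> 'a::euclidean_space \<Rightarrow> real"
  assumes "\<And>y. y \<noteq> b \<Longrightarrow> F (hyp_chart y) = 0"
  shows "(LINT x|hyp_volume. F x) = 0"
proof -
  have "(LINT y|lborel. 1 / sqrt (1 + (norm y)\<^sup>2) * F (hyp_chart y)) = (LINT y|(lborel::'a measure). 0)"
    by (rule integral_discrete_difference[where X = "{b}"]) (auto simp: assms)
  then show ?thesis
    using integral_hyp_volume(2)[of "{}" F b] assms by simp
qed

theorem corollary3p1:
  fixes N :: nat
    and x0 :: "real \<times> 'a::euclidean_space"
    and V W f :: "real \<Rightarrow> real"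
    and u :: "real \<times> 'a \<Rightarrow> real"
  defines "r \<equiv> (\<lambda>x. hyp_dist x x0)"
  assumes "DIM('a) = N" and "N \<ge> 2"
    and "x0 \<in> hyperboloid"
    and "bessel_pair (\<lambda>s. s ^ (N - 1) * V s) (\<lambda>s. s ^ (N - 1) * W s)"
    and "positive_solution (\<lambda>s. s ^ (N - 1) * V s) (\<lambda>s. s ^ (N - 1) * W s) f"
    and "u \<in> Cc_infinity (hyperboloid - {x0})"
  shows
    "(LINT x|hyp_volume. V (r x) * (radial_laplacian x0 u x)\<^sup>2) =
       (LINT x|hyp_volume. W (r x) * hyp_normsq (radial_grad x0 u x))
     + (real N - 1) * (LINT x|hyp_volume.
          (V (r x) / (sinh (r x))\<^sup>2 - deriv V (r x) * cosh (r x) / sinh (r x))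
            * hyp_normsq (radial_grad x0 u x))
     - (real N - 1) * (LINT x|hyp_volume.
          V (r x) * (deriv f (r x) / f (r x)) * (coth (r x) - 1 / r x)
            * hyp_normsq (radial_grad x0 u x))
     + (LINT x|hyp_volume.
          V (r x) * (f (r x))\<^sup>2
            * hyp_normsq (radial_grad x0 (\<lambda>y. radial_deriv x0 u y / f (r y)) x))"
proof -
  define b where "b = snd x0"
  define n where "n = N - 1"
  let ?S = "- {b}"
  let ?h = "\<lambda>y. radial_deriv x0 u (hyp_chart y)"
  let ?h2 = "\<lambda>y. radial_deriv x0 (radial_deriv x0 u) (hyp_chart y)"
  \<comment> \<open>As \<open>N \<ge> 2\<close>, the natural number subtraction does not truncate,
    so the exponent in the Bessel pair and the dimension factor are the same number.\<close>
  have n: "real N - 1 = real n" "real DIM('a) - 1 = real n" using assms(2,3) by (auto simp: n_def)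
  have x0: "x0 \<in> hyperboloid" by (rule assms(4))
  have rpos: "r (hyp_chart y) > 0" if "y \<noteq> b" for y
    using hyp_dist_pos[OF x0] that by (simp add: r_def b_def)
  obtain V' where V': "\<And>s. s > 0 \<Longrightarrow> (V has_real_derivative V' s) (at s)" "continuous_on {0<..} V'"
    using assms(5) C1_cancel_power[of "N - 1" V] unfolding bessel_pair_def by blast
  obtain W' where W': "\<And>s. s > 0 \<Longrightarrow> (W has_real_derivative W' s) (at s)"
    using assms(5) C1_cancel_power[of "N - 1" W] unfolding bessel_pair_def by blast
  obtain f' where f': "\<And>s. s > 0 \<Longrightarrow> (f has_real_derivative f' s) (at s)" "continuous_on {0<..} f'"
    using assms(6) C1_cancel_power[of 0 f] unfolding positive_solution_def by auto
  have f: "f s > 0" if "s > 0" for s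
    using assms(6) that unfolding positive_solution_def by blast
  have dV: "deriv V s = V' s" if "s > 0" for s using V'(1)[OF that] by (rule DERIV_imp_deriv)
  have df: "deriv f s = f' s" if "s > 0" for s using f'(1)[OF that] by (rule DERIV_imp_deriv)
  have cV: "continuous_on {0<..} V" and cW: "continuous_on {0<..} W" and cf: "continuous_on {0<..} f"
    using V'(1) W' f'(1) by (force intro!: continuous_at_imp_continuous_on DERIV_isCont)+
  \<comment> \<open>The combination that the equation makes differentiable although
    \<open>f''\<close> may fail to exist: cancelling \<open>s^n\<close> in
    \<open>(s^n T)' = - s^n W f\<close> yields \<open>T' = - W f - n T / s\<close>.\<close>
  define T where "T s = V s * f' s" for s
  have T: "(T has_real_derivative - W s * f s - real n / s * T s) (at s)" if "s > 0" for s
  proof -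
    let ?E = "\<lambda>s. s ^ n * V s * deriv f s"
    have "?E differentiable (at s)" "deriv ?E s + s ^ n * W s * f s = 0"
      using assms(6) that unfolding positive_solution_def n_def[symmetric] by blast+
    then have "(?E has_real_derivative - (s ^ n * W s * f s)) (at s)"
      unfolding DERIV_deriv_iff_real_differentiable[symmetric] eq_neg_iff_add_eq_0[symmetric] by simp
    then have "((\<lambda>s. (s ^ n * V s * deriv f s) / s ^ n) has_real_derivative
        (- (s ^ n * W s * f s) * s ^ n - (s ^ n * V s * deriv f s) * (real n * s ^ (n - 1))) / (s ^ n * s ^ n)) (at s)"
      using that DERIV_pow[of n s] by (intro DERIV_divide) auto
    moreover have "(- (s ^ n * W s * f s) * s ^ n - (s ^ n * V s * deriv f s) * (real n * s ^ (n - 1)))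
        / (s ^ n * s ^ n) = - W s * f s - real n / s * T s"
      using that by (cases n) (auto simp: T_def df field_simps)
    ultimately have "((\<lambda>s. (s ^ n * V s * deriv f s) / s ^ n) has_real_derivative
        - W s * f s - real n / s * T s) (at s)" by simp
    then show ?thesis
      by (rule has_field_derivative_transform_within_open[of _ _ _ "{0<..}"])
        (use that in \<open>auto simp: T_def df\<close>)
  qed
  define A where "A s = real n * (V s * coth s) + T s / f s" for s
  define A' where "A' s = real n * (V' s * coth s - V s / (sinh s)\<^sup>2)
    + ((- W s * f s - real n / s * T s) * f s - T s * f' s) / (f s * f s)" for s
  have coth: "(coth has_real_derivative - 1 / (sinh s)\<^sup>2) (at s)" if "s > 0" for s :: real
  proof -
    have "((\<lambda>s. cosh s / sinh s) has_real_derivative (sinh s * sinh s - cosh s * cosh s) / (sinh s * sinh s)) (at s)"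
      using that by (intro DERIV_divide) (auto intro!: derivative_eq_intros)
    then show ?thesis
      unfolding coth_def[abs_def]
      by (rule DERIV_cong) (simp add: power2_eq_square[symmetric] cosh_square_eq)
  qed
  have A: "(A has_real_derivative A' s) (at s)" if "s > 0" for s
    unfolding A_def[abs_def] A'_def
    by (rule DERIV_cong[OF DERIV_add[OF DERIV_cmult[OF DERIV_mult[OF V'(1) coth]] DERIV_divide[OF T f'(1)]]])
      (use that f[OF that] in \<open>auto simp: algebra_simps\<close>)
  have ccoth: "continuous_on {0<..} (coth :: real \<Rightarrow> real)"
    unfolding coth_def[abs_def] by (intro continuous_intros) auto
  have cA': "continuous_on {0<..} A'"
    unfolding A'_def[abs_def] T_def
    using f by (intro continuous_intros V' f' cV cW cf ccoth) (force simp: less_imp_neq)+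
  have u: "C_infinity (\<lambda>y. u (hyp_chart y))" using assms(7) by (simp add: Cc_infinity_def o_def)
  obtain K0 where K0: "compact K0" "K0 \<subseteq> hyperboloid - {x0}" "\<And>x. x \<in> hyperboloid - K0 \<Longrightarrow> u x = 0"
    using assms(7) unfolding Cc_infinity_def by blast
  \<comment> \<open>\<open>snd\<close> inverts the chart on the hyperboloid, so \<open>K\<close> is
    \<open>K0\<close> read in the chart; it avoids \<open>b\<close> because \<open>K0\<close> avoids
    \<open>x0\<close>.\<close>
  define K where "K = snd ` K0"
  have K: "compact K" unfolding K_def
    by (intro compact_continuous_image K0(1) continuous_intros)
  have bK: "b \<notin> K"
  proof
    assume "b \<in> K"
    then obtain x where "x \<in> K0" "snd x = snd x0" unfolding K_def b_def by auto
    then have "x = x0" using K0(2) x0 hyp_chart_snd by (metis Diff_iff subsetD)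
    then show False using \<open>x \<in> K0\<close> K0(2) by blast
  qed
  have Kc: "open (- K)" using K by (simp add: compact_imp_closed open_Compl)
  have u0: "u (hyp_chart y) = 0" if "y \<in> - K" for y
    using that K0(3)[of "hyp_chart y"] hyp_chart_in_hyperboloid[of y] unfolding K_def
    by (metis ComplD Diff_iff image_eqI snd_hyp_chart)
  have h0: "?h y = 0" if "y \<in> - K" "y \<noteq> b" for y
    using radial_deriv_eq_0[OF x0 _ Kc that(1)] u0 that(2) unfolding b_def by blast
  have h20: "?h2 y = 0" if "y \<in> - K" "y \<noteq> b" for y
    using radial_deriv_eq_0[OF x0 _ Kc that(1)] h0 that(2) unfolding b_def by blast
  have C1h: "C1_on ?S ?h" unfolding b_def by (rule C1_on_radial_deriv[OF x0 u])
  have ch: "continuous_on ?S ?h" by (rule C1_on_continuous[OF C1h])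
  have ch2: "continuous_on ?S ?h2"
    unfolding b_def by (rule continuous_on_radial_deriv[OF x0 C1h[unfolded b_def]])
  have cr: "continuous_on ?S (\<lambda>y. q (r (hyp_chart y)))" if "continuous_on {0<..} q" for q :: "real \<Rightarrow> real"
    using continuous_on_radial_compose[OF x0 that] by (simp add: r_def b_def)
  \<comment> \<open>For each integrand, \<open>\<phi>\<close> is an explicit formula in
    \<open>?h\<close>, \<open>?h2\<close> and functions of the distance. Continuity on the punctured
    chart suffices, as \<open>K\<close> misses the pole.\<close>
  have int: "integrable hyp_volume F"
    if F: "\<And>y. y \<noteq> b \<Longrightarrow> F (hyp_chart y) = \<phi> y" and c: "continuous_on ?S \<phi>"
      and 0: "\<And>y. y \<in> - K \<Longrightarrow> y \<noteq> b \<Longrightarrow> \<phi> y = 0" for F and \<phi> :: "'a \<Rightarrow> real"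
  proof (rule integral_hyp_volume(1)[OF K])
    have "continuous_on K \<phi>" using bK by (intro continuous_on_subset[OF c]) auto
    then show "continuous_on K (\<lambda>y. F (hyp_chart y))"
      by (rule continuous_on_cong[OF refl, THEN iffD2, rotated -1]) (metis F bK)
    show "F (hyp_chart y) = 0" if "y \<notin> K" "y \<noteq> b" for y
      using F 0 that by simp
  qed
  let ?q = "\<lambda>x. radial_deriv x0 u x / f (r x)"
  have q': "((\<lambda>s. 1 / f s) has_real_derivative - f' s / (f s)\<^sup>2) (at s)" if "s > 0" for s
    using f[OF that] f'(1)[OF that]
    by (auto intro!: derivative_eq_intros simp: power2_eq_square)
  \<comment> \<open>The factor \<open>1 / f\<close> left outside is absorbed by the weight
    \<open>f^2\<close> of the last integral, so only the quotient \<open>f' / f\<close> survives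
    there.\<close>
  have rq: "radial_deriv x0 ?q (hyp_chart y) =
      (?h2 y - ?h y * (f' (r (hyp_chart y)) / f (r (hyp_chart y)))) / f (r (hyp_chart y))" if "y \<noteq> b" for y
  proof -
    have y: "y \<noteq> snd x0" using that by (simp add: b_def)
    have C: "C1_on (- {snd x0}) (\<lambda>y. 1 / f (hyp_dist (hyp_chart y) x0))"
      by (rule C1_on_radial_compose[OF x0 q'])
        (use f in \<open>force intro!: continuous_intros f' cf\<close>)+
    have "radial_deriv x0 (\<lambda>x. radial_deriv x0 u x * (1 / f (hyp_dist x x0))) (hyp_chart y) =
        ?h2 y * (1 / f (r (hyp_chart y))) + ?h y * (- f' (r (hyp_chart y)) / (f (r (hyp_chart y)))\<^sup>2)"
      unfolding radial_deriv_mult[OF x0 y C1h[unfolded b_def] C]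
        radial_deriv_compose_hyp_dist[OF x0 y q'[OF hyp_dist_pos[OF x0 y]]] r_def ..
    also have "\<dots> = (?h2 y - ?h y * (f' (r (hyp_chart y)) / f (r (hyp_chart y)))) / f (r (hyp_chart y))"
      using f[OF rpos[OF that]] by (simp add: field_simps power2_eq_square)
    finally show ?thesis by (simp add: r_def)
  qed
  let ?g = "\<lambda>x. A (hyp_dist x x0) * (radial_deriv x0 u x * radial_deriv x0 u x)"
  let ?J = "\<lambda>x. radial_deriv x0 ?g x + (real DIM('a) - 1) * coth (hyp_dist x x0) * ?g x"
  have C1A: "C1_on (- {snd x0}) (\<lambda>y. A (hyp_dist (hyp_chart y) x0))"
    by (rule C1_on_radial_compose[OF x0 A cA'])
  have C1hh: "C1_on (- {snd x0}) (\<lambda>y. ?h y * ?h y)"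
    using C1h unfolding b_def by (intro C1_on_mult)
  have rg: "radial_deriv x0 ?g (hyp_chart y) = A' (r (hyp_chart y)) * (?h y)\<^sup>2
      + A (r (hyp_chart y)) * (2 * ?h y * ?h2 y)" if "y \<noteq> b" for y
  proof -
    have y: "y \<noteq> snd x0" using that by (simp add: b_def)
    show ?thesis
      unfolding radial_deriv_mult[OF x0 y C1A C1hh] radial_deriv_compose_hyp_dist[OF x0 y A[OF hyp_dist_pos[OF x0 y]]]
        radial_deriv_mult[OF x0 y C1h[unfolded b_def] C1h[unfolded b_def]] r_def
      by (simp add: power2_eq_square)
  qed
  have J: "integrable hyp_volume ?J" "(LINT x|hyp_volume. ?J x) = 0"
    by (rule integral_hyp_volume_radial_divergence[OF x0 C1_on_mult[OF C1A C1hh] K bK[unfolded b_def]];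
        use h0 in \<open>simp add: b_def\<close>)+
  have ns: "hyp_normsq (radial_grad x0 g (hyp_chart y)) = (radial_deriv x0 g (hyp_chart y))\<^sup>2"
    if "y \<noteq> b" for y g
    using hyp_normsq_radial_grad[OF x0] that by (simp add: b_def)
  let ?I1 = "\<lambda>x. V (r x) * (radial_laplacian x0 u x)\<^sup>2"
  let ?I2 = "\<lambda>x. W (r x) * hyp_normsq (radial_grad x0 u x)"
  let ?I3 = "\<lambda>x. (V (r x) / (sinh (r x))\<^sup>2 - deriv V (r x) * cosh (r x) / sinh (r x))
    * hyp_normsq (radial_grad x0 u x)"
  let ?I4 = "\<lambda>x. V (r x) * (deriv f (r x) / f (r x)) * (coth (r x) - 1 / r x)
    * hyp_normsq (radial_grad x0 u x)"
  let ?I5 = "\<lambda>x. V (r x) * (f (r x))\<^sup>2 * hyp_normsq (radial_grad x0 ?q x)"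
  have e1: "?I1 (hyp_chart y) = V (r (hyp_chart y)) * (?h2 y + real n * coth (r (hyp_chart y)) * ?h y)\<^sup>2" for y
    by (simp add: radial_laplacian_def n r_def)
  have e2: "?I2 (hyp_chart y) = W (r (hyp_chart y)) * (?h y)\<^sup>2" if "y \<noteq> b" for y
    using ns[OF that] by simp
  have e3: "?I3 (hyp_chart y) = (V (r (hyp_chart y)) / (sinh (r (hyp_chart y)))\<^sup>2
      - V' (r (hyp_chart y)) * coth (r (hyp_chart y))) * (?h y)\<^sup>2" if "y \<noteq> b" for y
    using ns[OF that] dV[OF rpos[OF that]] by (simp add: coth_def)
  have e4: "?I4 (hyp_chart y) = V (r (hyp_chart y)) * (f' (r (hyp_chart y)) / f (r (hyp_chart y)))
      * (coth (r (hyp_chart y)) - 1 / r (hyp_chart y)) * (?h y)\<^sup>2" if "y \<noteq> b" for y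
    using ns[OF that] df[OF rpos[OF that]] by simp
  have e5: "?I5 (hyp_chart y) = V (r (hyp_chart y))
      * (?h2 y - ?h y * (f' (r (hyp_chart y)) / f (r (hyp_chart y))))\<^sup>2" if "y \<noteq> b" for y
    unfolding ns[OF that] rq[OF that] using f[OF rpos[OF that]] by (simp add: power_divide)
  have nz: "r (hyp_chart y) \<noteq> 0" "f (r (hyp_chart y)) \<noteq> 0" if "y \<noteq> b" for y
    using rpos[OF that] f[OF rpos[OF that]] by auto
  note crs = cr[OF cV] cr[OF V'(2)] cr[OF cW] cr[OF cf] cr[OF f'(2)] cr[OF ccoth] cr[OF continuous_on_id]
  \<comment> \<open>The Bochner integral of a non-integrable function defaults to 0, so each
    integrand must be integrable before the integral of the sum can be split.\<close>
  have i1: "integrable hyp_volume ?I1"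
    by (rule int, rule e1) (auto intro!: continuous_intros crs ch ch2 simp: nz h0 h20)
  have i2: "integrable hyp_volume ?I2"
    by (rule int, erule e2) (auto intro!: continuous_intros crs ch ch2 simp: nz h0 h20)
  have i3: "integrable hyp_volume ?I3"
    by (rule int, erule e3) (auto intro!: continuous_intros crs ch ch2 simp: nz h0 h20)
  have i4: "integrable hyp_volume ?I4"
    by (rule int, erule e4) (auto intro!: continuous_intros crs ch ch2 simp: nz h0 h20)
  have i5: "integrable hyp_volume ?I5"
    by (rule int, erule e5) (auto intro!: continuous_intros crs ch ch2 simp: nz h0 h20)
  let ?D = "\<lambda>x. ?I1 x - (?I2 x + real n * ?I3 x - real n * ?I4 x + ?I5 x) - ?J x"
  \<comment> \<open>The variables \<open>k\<close>, \<open>e\<close>, \<open>\<phi>\<close>,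
    \<open>t\<close> stand for \<open>coth r\<close>, \<open>1 / sinh^2 r\<close>,
    \<open>f' / f\<close>, \<open>1 / r\<close>. With them as independent unknowns the pointwise
    identity becomes polynomial.\<close>
  have algebra: "v * (h2 + m * k * h)\<^sup>2 - (w * h\<^sup>2 + m * ((v * e - v' * k) * h\<^sup>2)
        - m * (v * \<phi> * (k - t) * h\<^sup>2) + v * (h2 - h * \<phi>)\<^sup>2)
      - ((m * (v' * k - v * e) + (- w - m * t * (v * \<phi>) - v * \<phi>\<^sup>2)) * h\<^sup>2
        + (m * (v * k) + v * \<phi>) * (2 * h * h2) + m * k * ((m * (v * k) + v * \<phi>) * (h * h))) = 0"
    for v v' w h h2 m k e \<phi> t :: real
    by algebra
  have D: "?D (hyp_chart y) = 0" if "y \<noteq> b" for y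
  proof -
    define s where "s = r (hyp_chart y)"
    have s: "s > 0" unfolding s_def by (rule rpos[OF that])
    have rd: "hyp_dist (hyp_chart y) x0 = r (hyp_chart y)" by (simp add: r_def)
    have As: "A s = real n * (V s * coth s) + V s * (f' s / f s)"
      by (simp add: A_def T_def)
    have A's: "A' s = real n * (V' s * coth s - V s * (1 / (sinh s)\<^sup>2))
        + (- W s - real n * (1 / s) * (V s * (f' s / f s)) - V s * (f' s / f s)\<^sup>2)"
      using f[OF s] s by (simp add: A'_def T_def field_simps power2_eq_square)
    show ?thesis
      unfolding e1 e2[OF that] e3[OF that] e4[OF that] e5[OF that] rg[OF that] n(2)
      unfolding rd s_def[symmetric] As A's
      using algebra[of "V s" "?h2 y" "real n" "coth s" "?h y" "W s" "1 / (sinh s)\<^sup>2" "V' s" "f' s / f s" "1 / s"]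
      by simp
  qed
  \<comment> \<open>Abstract integrands keep \<open>simp\<close> from rewriting inside the concrete
    ones.\<close>
  have linear: "(LINT x|M. F1 x - (F2 x + c * F3 x - c * F4 x + F5 x) - F6 x) =
      integral\<^sup>L M F1 - (integral\<^sup>L M F2 + c * integral\<^sup>L M F3 - c * integral\<^sup>L M F4
        + integral\<^sup>L M F5) - integral\<^sup>L M F6"
    if "integrable M F1" "integrable M F2" "integrable M F3" "integrable M F4" "integrable M F5" "integrable M F6"
    for M :: "(real \<times> 'a) measure" and c :: real and F1 F2 F3 F4 F5 F6
    using that by simp
  have "(LINT x|hyp_volume. ?D x) = 0"
    by (rule integral_hyp_volume_eq_0) (rule D)
  moreover have "(LINT x|hyp_volume. ?D x) = (LINT x|hyp_volume. ?I1 x) - ((LINT x|hyp_volume. ?I2 x)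
      + real n * (LINT x|hyp_volume. ?I3 x) - real n * (LINT x|hyp_volume. ?I4 x) + (LINT x|hyp_volume. ?I5 x))
      - (LINT x|hyp_volume. ?J x)"
    by (rule linear[OF i1 i2 i3 i4 i5 J(1)])
  ultimately show ?thesis
    unfolding n(1) J(2) by linarith
qed

end
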